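(* Let $\Phi:\Omega_{\mathcal M}\to\Omega_{\mathcal N}$ be a map between two manifolds and let $\pi$ be either the projection $\pi_h=\mathcal I\circ\mathcal R$ on the primal cell complexes or the projection $\tilde\pi_h=\tilde{\mathcal I}\circ\tilde{\mathcal R}$ on the dual cell complexes. Then $\pi$ commutes with the pullback $\Phi^\star$: $$\Phi^\star\,\pi=\pi\,\Phi^\star\qquad\text{on }\Lambda^k(\Omega_{\mathcal N}),$$ where $\pi$ on the left is the projection on $\Omega_{\mathcal N}$ and $\pi$ on the right is the projection on $\Omega_{\mathcal M}$.
   Context: $\Omega_{\mathcal M},\Omega_{\mathcal N}$ are $n$-dimensional manifolds, $\Phi$ is a smooth homeomorphism, and $\Lambda^k(\cdot)$ denotes differential $k$-forms. $D_{\mathcal M}$ is a finite cell complex covering $\Omega_{\mathcal M}$ whose cells are non-degenerate singular cubes $\tau_{(k)}:[-1,1]^k\to\Omega_{\mathcal M}$, and $D_{\mathcal N}$ is the corresponding cell complex covering $\Omega_{\mathcal N}$, so that the chain map $\Phi_\sharp:C_k(D_{\mathcal M})\to C_k(D_{\mathcal N})$, $\Phi_\sharp(\tau_{(k)})=\Phi\circ\tau_{(k)}$ (extended linearly to $k$-chains), is defined. $C^k(D)=\mathrm{Hom}(C_k(D),\mathbb R)$ is the space of $k$-cochains. The cochain map $\Phi^\sharp:C^k(D_{\mathcal N})\to C^k(D_{\mathcal M})$ is defined by $\langle\Phi^\sharp c^{(k)},c_{(k)}\rangle=\langle c^{(k)},\Phi_\sharp c_{(k)}\rangle$. Reduction on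 either complex: $\mathcal R:\Lambda^k\to C^k(D)$, $\langle\mathcal Ra^{(k)},c_{(k)}\rangle=\int_{c_{(k)}}a^{(k)}$. Reconstruction on either complex: a linear map $\mathcal I:C^k(D)\to\Lambda^k$ with $\mathcal R\,\mathcal I=\mathrm{Id}$ on $C^k(D)$, required by the framework to commute with the continuous and discrete pullback: $\mathcal I\,\Phi^\sharp=\Phi^\star\,\mathcal I$ on $C^k(D_{\mathcal N})$. $\tilde{\mathcal R},\tilde{\mathcal I}$ are the corresponding operators for the dual cell complexes and satisfy the same properties. *)

theory Defs
  imports "HOL-Analysis.Analysis"
begin

section \<open>Smooth maps between subsets of Euclidean spaces\<close>

primrec Ck_on :: "nat \<Rightarrow> 'a::real_normed_vector set \<Rightarrow> ('a \<Rightarrow> 'b::real_normed_vector) \<Rightarrow> bool" where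
  "Ck_on 0 U f \<longleftrightarrow> continuous_on U f"
| "Ck_on (Suc m) U f \<longleftrightarrow>
     (\<forall>x\<in>U. f differentiable (at x)) \<and> (\<forall>v. Ck_on m U (\<lambda>x. frechet_derivative f (at x) v))"

text \<open>On a set that need not be open, smooth means: locally the restriction of a
  \<open>C\<^sup>\<infinity>\<close> map on an open set.\<close>

definition smooth_on :: "'a::real_normed_vector set \<Rightarrow> ('a \<Rightarrow> 'b::real_normed_vector) \<Rightarrow> bool" where
  "smooth_on S f \<longleftrightarrow>
     (\<forall>x\<in>S. \<exists>U g. open U \<and> x \<in> U \<and> (\<forall>m. Ck_on m U g) \<and> (\<forall>y\<in>S \<inter> U. g y = f y))"


section \<open>Smooth manifolds\<close>

text \<open>
  The dimension of a manifold is \<open>CARD('n)\<close>. A chart is a pair of a domain and a coordinate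
  map. Boundary and corners are allowed, since a space covered by finitely many
  cells is compact and typically has them (for instance \<open>[-1,1]\<^sup>n\<close>); manifolds without boundary
  are the case where every chart has an open image, i.e. \<open>J = {}\<close> below.
\<close>

type_synonym ('a, 'n) chart = "'a set \<times> ('a \<Rightarrow> real ^ 'n)"

record ('a, 'n) manifold =
  mtop :: "'a topology"
  atlas :: "('a, 'n) chart set"

abbreviation points :: "('a, 'n) manifold \<Rightarrow> 'a set" where
  "points M \<equiv> topspace (mtop M)"

definition sector :: "'n set \<Rightarrow> (real ^ 'n) set" where
  "sector J = {x. \<forall>i\<in>J. 0 \<le> x $ i}"

definition is_chart :: "'a topology \<Rightarrow> ('a, 'n::finite) chart \<Rightarrow> bool" where
  "is_chart X c \<longleftrightarrow>
     openin X (fst c) \<and>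
     homeomorphic_map (subtopology X (fst c)) (top_of_set (snd c ` fst c)) (snd c) \<and>
     (\<exists>J. openin (top_of_set (sector J)) (snd c ` fst c))"

definition chart_inv :: "('a, 'n) chart \<Rightarrow> real ^ 'n \<Rightarrow> 'a" where
  "chart_inv c = inv_into (fst c) (snd c)"

definition local_dom ::
    "('a, 'n) chart \<Rightarrow> ('b, 'm) chart \<Rightarrow> ('a \<Rightarrow> 'b) \<Rightarrow> (real ^ 'n) set" where
  "local_dom c d f = snd c ` {p \<in> fst c. f p \<in> fst d}"

definition local_rep ::
    "('a, 'n) chart \<Rightarrow> ('b, 'm) chart \<Rightarrow> ('a \<Rightarrow> 'b) \<Rightarrow> real ^ 'n \<Rightarrow> real ^ 'm" where
  "local_rep c d f = (\<lambda>x. snd d (f (chart_inv c x)))"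

definition smooth_manifold :: "('a, 'n::finite) manifold \<Rightarrow> bool" where
  "smooth_manifold M \<longleftrightarrow>
     Hausdorff_space (mtop M) \<and> second_countable (mtop M) \<and>
     (\<forall>c\<in>atlas M. is_chart (mtop M) c) \<and>
     (\<Union>c\<in>atlas M. fst c) = points M \<and>
     (\<forall>c\<in>atlas M. \<forall>d\<in>atlas M. smooth_on (local_dom c d (\<lambda>p. p)) (local_rep c d (\<lambda>p. p)))"

definition smooth_homeomorphism ::
    "('a, 'n::finite) manifold \<Rightarrow> ('b, 'm::finite) manifold \<Rightarrow> ('a \<Rightarrow> 'b) \<Rightarrow> bool" where
  "smooth_homeomorphism M N f \<longleftrightarrow>
     homeomorphic_map (mtop M) (mtop N) f \<and>
     (\<forall>c\<in>atlas M. \<forall>d\<in>atlas N. smooth_on (local_dom c d f) (local_rep c d f))"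


section \<open>Tangent vectors and differential forms\<close>

definition charts_at :: "('a, 'n) manifold \<Rightarrow> 'a \<Rightarrow> ('a, 'n) chart set" where
  "charts_at M p = {c \<in> atlas M. p \<in> fst c}"

text \<open>Derivative at \<open>p\<close> of the representation of \<open>f\<close> in the charts \<open>c\<close> and \<open>d\<close>; the
  derivative is one-sided where \<open>p\<close> is a boundary point, and unique there too because the
  domain is relatively open in a sector.\<close>

definition local_deriv ::
    "('a, 'n::finite) chart \<Rightarrow> ('b, 'm::finite) chart \<Rightarrow> ('a \<Rightarrow> 'b) \<Rightarrow> 'a \<Rightarrow> real ^ 'n \<Rightarrow> real ^ 'm"
where
  "local_deriv c d f p = frechet_derivative (local_rep c d f) (at (snd c p) within local_dom c d f)"

text \<open>A tangent vector at \<open>p\<close> is given by its components in all charts around \<open>p\<close>, related by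
  the derivatives of the transition maps.\<close>

type_synonym ('a, 'n) tvec = "('a, 'n) chart \<Rightarrow> real ^ 'n"

definition tangent_space :: "('a, 'n::finite) manifold \<Rightarrow> 'a \<Rightarrow> ('a, 'n) tvec set" where
  "tangent_space M p =
     {X. (\<forall>c\<in>charts_at M p. \<forall>d\<in>charts_at M p. X d = local_deriv c d (\<lambda>q. q) p (X c)) \<and>
         (\<forall>c. c \<notin> charts_at M p \<longrightarrow> X c = 0)}"

definition coord_tvec ::
    "('a, 'n::finite) manifold \<Rightarrow> ('a, 'n) chart \<Rightarrow> 'a \<Rightarrow> real ^ 'n \<Rightarrow> ('a, 'n) tvec" where
  "coord_tvec M c p v = (\<lambda>d. if d \<in> charts_at M p then local_deriv c d (\<lambda>q. q) p v else 0)"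

definition tangent_map ::
    "('a, 'n::finite) manifold \<Rightarrow> ('b, 'm::finite) manifold \<Rightarrow> ('a \<Rightarrow> 'b) \<Rightarrow> 'a
      \<Rightarrow> ('a, 'n) tvec \<Rightarrow> ('b, 'm) tvec" where
  "tangent_map M N f p X =
     (let c = (SOME c. c \<in> charts_at M p)
      in (\<lambda>d. if d \<in> charts_at N (f p) then local_deriv c d f p (X c) else 0))"

text \<open>A form takes a point and a list of tangent vectors at this point. All other
  arguments are mapped to 0, so that forms are determined by their relevant values.\<close>

type_synonym ('a, 'n) form = "'a \<Rightarrow> ('a, 'n) tvec list \<Rightarrow> real"

definition diff_forms :: "('a, 'n::finite) manifold \<Rightarrow> nat \<Rightarrow> ('a, 'n) form set" where
  "diff_forms M k =
     {a. (\<forall>p Xs. \<not> (p \<in> points M \<and> length Xs = k \<and> set Xs \<subseteq> tangent_space M p) \<longrightarrow> a p Xs = 0) \<and>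
         (\<forall>p\<in>points M. \<forall>Xs. length Xs = k \<and> set Xs \<subseteq> tangent_space M p \<longrightarrow>
            (\<forall>i<k. \<forall>X\<in>tangent_space M p. \<forall>Y\<in>tangent_space M p. \<forall>r.
               a p (Xs[i := (\<lambda>c. r *\<^sub>R X c + Y c)]) = r * a p (Xs[i := X]) + a p (Xs[i := Y])) \<and>
            (\<forall>i<k. \<forall>j<k. i \<noteq> j \<and> Xs ! i = Xs ! j \<longrightarrow> a p Xs = 0)) \<and>
         (\<forall>c\<in>atlas M. \<forall>vs. length vs = k \<longrightarrow>
            smooth_on (snd c ` fst c)
              (\<lambda>x. a (chart_inv c x) (map (coord_tvec M c (chart_inv c x)) vs)))}"

definition pullback ::
    "('a, 'n::finite) manifold \<Rightarrow> ('b, 'm::finite) manifold \<Rightarrow> ('a \<Rightarrow> 'b)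
      \<Rightarrow> ('b, 'm) form \<Rightarrow> ('a, 'n) form" where
  "pullback M N f a =
     (\<lambda>p Xs. if p \<in> points M \<and> set Xs \<subseteq> tangent_space M p
             then a (f p) (map (tangent_map M N f p) Xs) else 0)"


section \<open>Singular cubes and cell complexes\<close>

text \<open>Since \<open>k\<close> varies within a complex, \<open>[-1,1]\<^sup>k\<close> is the set of extensional functions
  on \<open>{..<k}\<close>; for \<open>k = 0\<close> it is a single point.\<close>

definition cube :: "nat \<Rightarrow> (nat \<Rightarrow> real) set" where
  "cube k = ({..<k} \<rightarrow>\<^sub>E {-1..1})"

definition cube_partial ::
    "nat \<Rightarrow> ((nat \<Rightarrow> real) \<Rightarrow> 'b::real_normed_vector) \<Rightarrow> (nat \<Rightarrow> real) \<Rightarrow> 'b" where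
  "cube_partial i f t = vector_derivative (\<lambda>s. f (t(i := s))) (at (t i) within {-1..1})"

text \<open>Smoothness on a relatively open subset \<open>W\<close> of the cube, up to the boundary of the cube:
  all iterated partial derivatives exist and are continuous.\<close>

primrec cube_Ck_on ::
    "nat \<Rightarrow> nat \<Rightarrow> (nat \<Rightarrow> real) set \<Rightarrow> ((nat \<Rightarrow> real) \<Rightarrow> 'b::real_normed_vector) \<Rightarrow> bool" where
  "cube_Ck_on k 0 W f \<longleftrightarrow> continuous_on W f"
| "cube_Ck_on k (Suc m) W f \<longleftrightarrow>
     continuous_on W f \<and>
     (\<forall>i<k. (\<forall>t\<in>W. (\<lambda>s. f (t(i := s))) differentiable (at (t i) within {-1..1})) \<and>
            cube_Ck_on k m W (cube_partial i f))"

type_synonym 'a cell = "(nat \<Rightarrow> real) \<Rightarrow> 'a"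

definition singular_cube :: "('a, 'n::finite) manifold \<Rightarrow> nat \<Rightarrow> 'a cell \<Rightarrow> bool" where
  "singular_cube M k \<tau> \<longleftrightarrow>
     \<tau> \<in> extensional (cube k) \<and>
     continuous_map (top_of_set (cube k)) (mtop M) \<tau> \<and>
     (\<forall>c\<in>atlas M. \<forall>m. cube_Ck_on k m {t \<in> cube k. \<tau> t \<in> fst c} (snd c \<circ> \<tau>))"

text \<open>A singular cube is degenerate if it does not depend on one of its coordinates.\<close>

definition nondegenerate :: "nat \<Rightarrow> 'a cell \<Rightarrow> bool" where
  "nondegenerate k \<tau> \<longleftrightarrow>
     (\<forall>i<k. \<exists>s\<in>cube k. \<exists>t\<in>cube k. (\<forall>j. j \<noteq> i \<longrightarrow> s j = t j) \<and> \<tau> s \<noteq> \<tau> t)"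

text \<open>The proper faces of a cell, as point sets: some coordinates are fixed to \<open>-1\<close> or \<open>1\<close>.
  Working with point sets allows neighbouring cells to parametrize and orient a
  common face differently.\<close>

definition proper_faces :: "nat \<Rightarrow> 'a cell \<Rightarrow> 'a set set" where
  "proper_faces k \<tau> =
     {\<tau> ` {t \<in> cube k. \<forall>i\<in>J. t i = e i} | J e.
        J \<noteq> {} \<and> J \<subseteq> {..<k} \<and> (\<forall>i\<in>J. e i \<in> {-1, 1})}"

text \<open>\<open>D k\<close> is the set of \<open>k\<close>-cells. Two distinct \<open>k\<close>-cells meet in common proper faces only
  (possibly none). A face may collapse to a lower dimension than that of its parameter domain.\<close>

definition cell_complex :: "('a, 'n::finite) manifold \<Rightarrow> (nat \<Rightarrow> 'a cell set) \<Rightarrow> bool" where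
  "cell_complex M D \<longleftrightarrow>
     (\<forall>k. finite (D k)) \<and> (\<forall>k>CARD('n). D k = {}) \<and>
     (\<forall>k. \<forall>\<tau>\<in>D k. singular_cube M k \<tau> \<and> nondegenerate k \<tau>) \<and>
     (\<Union>\<tau>\<in>D CARD('n). \<tau> ` cube CARD('n)) = points M \<and>
     (\<forall>k. \<forall>\<tau>\<in>D k. \<forall>S\<in>proper_faces k \<tau>. \<exists>l<k. \<exists>\<sigma>\<in>D l. S = \<sigma> ` cube l) \<and>
     (\<forall>k. \<forall>\<tau>\<in>D k. \<forall>\<sigma>\<in>D k. \<tau> \<noteq> \<sigma> \<longrightarrow>
        \<tau> ` cube k \<inter> \<sigma> ` cube k = \<Union>(proper_faces k \<tau> \<inter> proper_faces k \<sigma>))"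

text \<open>Every \<open>k\<close>-cell of \<open>D\<close> has its own dual \<open>(n-k)\<close>-cell in \<open>D'\<close>, and duality reverses
  inclusions. Additional cells in \<open>D'\<close> are permitted: on a manifold with boundary the parts
  of dual cells on the boundary are not themselves dual to cells of \<open>D\<close>.\<close>

definition dual_complex ::
    "('a, 'n::finite) manifold \<Rightarrow> (nat \<Rightarrow> 'a cell set) \<Rightarrow> (nat \<Rightarrow> 'a cell set) \<Rightarrow> bool" where
  "dual_complex M D D' \<longleftrightarrow>
     (\<exists>star. (\<forall>k\<le>CARD('n). inj_on (star k) (D k) \<and> star k ` D k \<subseteq> D' (CARD('n) - k)) \<and>
        (\<forall>k\<le>CARD('n). \<forall>l\<le>CARD('n). \<forall>\<tau>\<in>D k. \<forall>\<sigma>\<in>D l. \<tau> ` cube k \<subseteq> \<sigma> ` cube l \<longrightarrow>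
           star l \<sigma> ` cube (CARD('n) - l) \<subseteq> star k \<tau> ` cube (CARD('n) - k)))"

definition push_cell :: "nat \<Rightarrow> ('a \<Rightarrow> 'b) \<Rightarrow> 'a cell \<Rightarrow> 'b cell" where
  "push_cell k f \<tau> = compose (cube k) f \<tau>"

definition push_complex :: "('a \<Rightarrow> 'b) \<Rightarrow> (nat \<Rightarrow> 'a cell set) \<Rightarrow> nat \<Rightarrow> 'b cell set" where
  "push_complex f D = (\<lambda>k. push_cell k f ` D k)"


section \<open>Chains and cochains\<close>

text \<open>A \<open>k\<close>-chain is given by its real coefficients on the finitely many \<open>k\<close>-cells;
  a \<open>k\<close>-cochain is a linear functional on \<open>k\<close>-chains, extended by 0 to all other arguments.\<close>

type_synonym 'a chain = "'a cell \<Rightarrow> real"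
type_synonym 'a cochain = "'a chain \<Rightarrow> real"

definition chain_space :: "(nat \<Rightarrow> 'a cell set) \<Rightarrow> nat \<Rightarrow> 'a chain set" where
  "chain_space D k = {c. \<forall>\<tau>. \<tau> \<notin> D k \<longrightarrow> c \<tau> = 0}"

definition cochain_space :: "(nat \<Rightarrow> 'a cell set) \<Rightarrow> nat \<Rightarrow> 'a cochain set" where
  "cochain_space D k =
     {f. (\<forall>c\<in>chain_space D k. \<forall>c'\<in>chain_space D k. \<forall>r. f (\<lambda>\<tau>. r * c \<tau> + c' \<tau>) = r * f c + f c') \<and>
         (\<forall>c. c \<notin> chain_space D k \<longrightarrow> f c = 0)}"

definition chain_map ::
    "('a \<Rightarrow> 'b) \<Rightarrow> (nat \<Rightarrow> 'a cell set) \<Rightarrow> nat \<Rightarrow> 'a chain \<Rightarrow> 'b chain" where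
  "chain_map f D k c = (\<lambda>\<sigma>. \<Sum>\<tau> | \<tau> \<in> D k \<and> push_cell k f \<tau> = \<sigma>. c \<tau>)"

definition cochain_map ::
    "('a \<Rightarrow> 'b) \<Rightarrow> (nat \<Rightarrow> 'a cell set) \<Rightarrow> nat \<Rightarrow> 'b cochain \<Rightarrow> 'a cochain" where
  "cochain_map f D k g = (\<lambda>c. if c \<in> chain_space D k then g (chain_map f D k c) else 0)"


section \<open>Integration, reduction, reconstruction and projection\<close>

definition velocity :: "('a, 'n::finite) manifold \<Rightarrow> 'a cell \<Rightarrow> (nat \<Rightarrow> real) \<Rightarrow> nat \<Rightarrow> ('a, 'n) tvec"
where
  "velocity M \<tau> t i = (\<lambda>d. if d \<in> charts_at M (\<tau> t) then cube_partial i (snd d \<circ> \<tau>) t else 0)"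

text \<open>The integral over \<open>[-1,1]\<^sup>k\<close> of the coefficient
  \<open>a(\<partial>\<^sub>1\<tau>, \<dots>, \<partial>\<^sub>k\<tau>)\<close> of the pullback of \<open>a\<close> along \<open>\<tau>\<close>.\<close>

definition cell_integral :: "('a, 'n::finite) manifold \<Rightarrow> nat \<Rightarrow> 'a cell \<Rightarrow> ('a, 'n) form \<Rightarrow> real" where
  "cell_integral M k \<tau> a =
     (LINT t:cube k|PiM {..<k} (\<lambda>_. lborel). a (\<tau> t) (map (velocity M \<tau> t) [0..<k]))"

definition reduction ::
    "('a, 'n::finite) manifold \<Rightarrow> (nat \<Rightarrow> 'a cell set) \<Rightarrow> nat \<Rightarrow> ('a, 'n) form \<Rightarrow> 'a cochain" where
  "reduction M D k a =
     (\<lambda>c. if c \<in> chain_space D k then (\<Sum>\<tau>\<in>D k. c \<tau> * cell_integral M k \<tau> a) else 0)"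

definition reconstruction ::
    "('a, 'n::finite) manifold \<Rightarrow> (nat \<Rightarrow> 'a cell set) \<Rightarrow> nat \<Rightarrow> ('a cochain \<Rightarrow> ('a, 'n) form) \<Rightarrow> bool"
where
  "reconstruction M D k I \<longleftrightarrow>
     (\<forall>f\<in>cochain_space D k. I f \<in> diff_forms M k) \<and>
     (\<forall>f\<in>cochain_space D k. \<forall>g\<in>cochain_space D k. \<forall>r.
        I (\<lambda>c. r * f c + g c) = (\<lambda>p Xs. r * I f p Xs + I g p Xs)) \<and>
     (\<forall>f\<in>cochain_space D k. reduction M D k (I f) = f)"

definition projection ::
    "('a, 'n::finite) manifold \<Rightarrow> (nat \<Rightarrow> 'a cell set) \<Rightarrow> nat \<Rightarrow> ('a cochain \<Rightarrow> ('a, 'n) form)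
      \<Rightarrow> ('a, 'n) form \<Rightarrow> ('a, 'n) form" where
  "projection M D k I = I \<circ> reduction M D k"

end

theory Submission
  imports Defs
begin

text \<open>
  Once reduction is natural, \<open>\<R> \<Phi>\<^sup>\<star> = \<Phi>\<^sup>\<sharp> \<R>\<close>, the claim is
  \<open>\<Phi>\<^sup>\<star> \<I> \<R> = \<I> \<Phi>\<^sup>\<sharp> \<R> = \<I> \<R> \<Phi>\<^sup>\<star>\<close>. Naturality of reduction is the equality of the integral
  of a form over \<open>\<Phi> \<circ> \<tau>\<close> with that of its pullback over \<open>\<tau>\<close>. The integrands agree at every
  point of the cube, since by the chain rule the velocities of \<open>\<Phi> \<circ> \<tau>\<close> are the images of those
  of \<open>\<tau>\<close> under the tangent map.
\<close>

section \<open>Local extensions and coordinate lines of the cube\<close>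

text \<open>The local extension \<open>g\<close> is differentiable at \<open>x\<close> and agrees
  with \<open>f\<close> on \<open>S \<inter> U\<close>. Since \<open>U\<close> is open, derivatives
  within \<open>S \<inter> U\<close> and within \<open>S\<close> are the same at
  \<open>x\<close>.\<close>

lemma smooth_on_differentiable:
  assumes "smooth_on S f" "x \<in> S"
  shows "f differentiable (at x within S)"
proof -
  obtain U g where U: "open U" "x \<in> U" and g: "\<And>m. Ck_on m U g" "\<And>y. y \<in> S \<inter> U \<Longrightarrow> g y = f y"
    using assms unfolding smooth_on_def by meson
  have "g differentiable (at x)"
    using g(1)[of "Suc 0"] U(2) by simp
  then obtain g' where "(g has_derivative g') (at x within S \<inter> U)"
    using has_derivative_at_withinI unfolding differentiable_def by blast
  then have "(f has_derivative g') (at x within S \<inter> U)"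
    using g(2) U(2) assms(2) by (intro has_derivative_transform[of x "S \<inter> U" f g]) auto
  moreover have "at x within S \<inter> U = at x within S"
    using U by (intro at_within_nhd[of x U]) auto
  ultimately show ?thesis
    unfolding differentiable_def by auto
qed

lemma cube_upd:
  assumes "t \<in> cube k" "i < k" "s \<in> {-1..1}"
  shows "t(i := s) \<in> cube k"
  using assms unfolding cube_def by (auto simp: PiE_iff extensional_def)

lemma cube_nth:
  assumes "t \<in> cube k" "i < k"
  shows "t i \<in> {-1..1}"
  using assms unfolding cube_def by (auto simp: PiE_iff)

text \<open>Functions carry the product topology, and each coordinate of the line is constant or the
  identity. Composing a cell with such a line turns a partial derivative into the derivative of a
  curve.\<close>

lemma continuous_map_cube_line:
  assumes "t \<in> cube k" "i < k"
  shows "continuous_map (top_of_set {-1..1}) (top_of_set (cube k)) (\<lambda>s. t(i := s))"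
proof -
  have "continuous_on {-1..1::real} (\<lambda>s. t(i := s))"
  proof (rule continuous_on_coordinatewise_then_product)
    fix j show "continuous_on {-1..1} (\<lambda>s. (t(i := s)) j)"
      by (cases "j = i") auto
  qed
  then show ?thesis
    using cube_upd[OF assms] by (auto simp: continuous_map_in_subtopology)
qed

lemma push_cell_apply: "t \<in> cube k \<Longrightarrow> push_cell k f \<tau> t = f (\<tau> t)"
  by (simp add: push_cell_def compose_def)

lemma singular_cube_points:
  assumes "singular_cube M k \<tau>" "t \<in> cube k"
  shows "\<tau> t \<in> points M"
  using assms unfolding singular_cube_def by (auto simp: continuous_map_def Pi_iff)

section \<open>Chain rule for velocities in charts\<close>

lemma is_chart_chart_inv:
  assumes "is_chart X c" "p \<in> fst c"
  shows "chart_inv c (snd c p) = p"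
proof -
  have "fst c \<subseteq> topspace X"
    using assms(1) unfolding is_chart_def by (blast dest: openin_subset)
  then have "inj_on (snd c) (fst c)"
    using assms(1) homeomorphic_imp_injective_map[of "subtopology X (fst c)" _ "snd c"]
    unfolding is_chart_def by (metis topspace_subtopology_subset)
  then show ?thesis
    using assms(2) by (simp add: chart_inv_def)
qed

text \<open>\<open>frechet_derivative\<close> may select any derivative here: each of them satisfies the chain rule
  along a curve that stays in the domain.\<close>

lemma cube_partial_push_cell:
  fixes M :: "('a, 'n::finite) manifold" and N :: "('b, 'm::finite) manifold"
  assumes M: "smooth_manifold M" and N: "smooth_manifold N"
    and f: "continuous_map (mtop M) (mtop N) f"
    and sm: "smooth_on (local_dom c d f) (local_rep c d f)"
    and \<tau>: "singular_cube M k \<tau>" and t: "t \<in> cube k" and i: "i < k"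
    and c: "c \<in> charts_at M (\<tau> t)" and d: "d \<in> charts_at N (f (\<tau> t))"
  shows "cube_partial i (snd d \<circ> push_cell k f \<tau>) t
    = local_deriv c d f (\<tau> t) (cube_partial i (snd c \<circ> \<tau>) t)"
proof -
  let ?L = "\<lambda>s. t(i := s)"
  let ?\<gamma> = "\<lambda>s. (snd c \<circ> \<tau>) (?L s)"
  let ?h = "local_rep c d f"
  have cM: "c \<in> atlas M" "\<tau> t \<in> fst c" and dN: "d \<in> atlas N" "f (\<tau> t) \<in> fst d"
    using c d by (auto simp: charts_at_def)
  have chc: "is_chart (mtop M) c" and chd: "is_chart (mtop N) d"
    using M N cM dN by (auto simp: smooth_manifold_def)
  \<comment> \<open>These are the parameters for which the curve and its image under
    \<open>f\<close> stay in the two chart domains, so that \<open>?h\<close> represents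
    \<open>f\<close> along it.\<close>
  define V where "V = {s \<in> {-1..1}. \<tau> (?L s) \<in> fst c \<and> f (\<tau> (?L s)) \<in> fst d}"
  have curve: "continuous_map (top_of_set {-1..1}) (mtop M) (\<lambda>s. \<tau> (?L s))"
    using continuous_map_compose[OF continuous_map_cube_line[OF t i], of "mtop M" \<tau>] \<tau>
    by (simp add: singular_cube_def o_def)
  have curve': "continuous_map (top_of_set {-1..1}) (mtop N) (\<lambda>s. f (\<tau> (?L s)))"
    using continuous_map_compose[OF curve f] by (simp add: o_def)
  have "openin (top_of_set {-1..1}) V"
  proof -
    have "V = {s \<in> topspace (top_of_set {-1..1}). \<tau> (?L s) \<in> fst c}
        \<inter> {s \<in> topspace (top_of_set {-1..1}). f (\<tau> (?L s)) \<in> fst d}"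
      by (auto simp: V_def)
    moreover have "openin (mtop M) (fst c)" "openin (mtop N) (fst d)"
      using chc chd by (auto simp: is_chart_def)
    ultimately show ?thesis
      using openin_continuous_map_preimage[OF curve] openin_continuous_map_preimage[OF curve']
      by (simp only: openin_Int)
  qed
  then obtain T where T: "open T" "V = {-1..1} \<inter> T"
    by (auto simp: openin_open)
  have ti: "t i \<in> {-1..1}" "t i \<in> V"
    using cube_nth[OF t i] cM dN by (auto simp: V_def)
  \<comment> \<open>\<open>V\<close> is relatively open in the interval, so it has the same limits
    at \<open>t i\<close>, one-sided ones at the endpoints included.\<close>
  then have VI: "at (t i) within V = at (t i) within {-1..1}"
    using T by (intro at_within_nhd[of _ T]) auto
  have \<gamma>V: "?\<gamma> ` V \<subseteq> local_dom c d f"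
    by (auto simp: V_def local_dom_def)
  have "?\<gamma> differentiable (at (t i) within {-1..1})"
  proof -
    \<comment> \<open>Order 0 only gives continuity; order 1 provides the partial
      derivatives.\<close>
    have "cube_Ck_on k (Suc 0) {t \<in> cube k. \<tau> t \<in> fst c} (snd c \<circ> \<tau>)"
      using \<tau> cM unfolding singular_cube_def by blast
    then show ?thesis
      using t i cM by simp
  qed
  then have d\<gamma>: "(?\<gamma> has_vector_derivative cube_partial i (snd c \<circ> \<tau>) t) (at (t i) within V)"
    unfolding VI cube_partial_def by (simp only: vector_derivative_works)
  have "snd c (\<tau> t) \<in> local_dom c d f"
    using cM dN by (auto simp: local_dom_def)
  then have "(?h has_derivative local_deriv c d f (\<tau> t)) (at (?\<gamma> (t i)) within local_dom c d f)"
    using smooth_on_differentiable[OF sm] unfolding local_deriv_def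
    by (simp add: frechet_derivative_works)
  \<comment> \<open>The chain rule needs the outer derivative within the image of the inner
    domain.\<close>
  then have dh: "(?h has_derivative local_deriv c d f (\<tau> t)) (at (?\<gamma> (t i)) within ?\<gamma> ` V)"
    using \<gamma>V by (rule has_derivative_subset)
  then have lin: "linear (local_deriv c d f (\<tau> t))"
    by (rule has_derivative_linear)
  have "((?h \<circ> ?\<gamma>) has_vector_derivative
      local_deriv c d f (\<tau> t) (cube_partial i (snd c \<circ> \<tau>) t)) (at (t i) within V)"
    using diff_chain_within[OF d\<gamma>[unfolded has_vector_derivative_def] dh]
    by (simp only: has_vector_derivative_def o_def linear_scale[OF lin])
  moreover have "(snd d \<circ> push_cell k f \<tau>) (?L s) = (?h \<circ> ?\<gamma>) s" if "s \<in> V" for s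
  proof -
    have "t(i := s) \<in> cube k" "chart_inv c (snd c (\<tau> (t(i := s)))) = \<tau> (t(i := s))"
      using that by (auto simp: V_def cube_upd[OF t i] is_chart_chart_inv[OF chc])
    then show ?thesis
      by (simp add: push_cell_apply local_rep_def)
  qed
  ultimately have "((\<lambda>s. (snd d \<circ> push_cell k f \<tau>) (?L s)) has_vector_derivative
      local_deriv c d f (\<tau> t) (cube_partial i (snd c \<circ> \<tau>) t)) (at (t i) within V)"
    using has_vector_derivative_transform[OF ti(2), of "\<lambda>s. (snd d \<circ> push_cell k f \<tau>) (?L s)" "?h \<circ> ?\<gamma>"]
    by blast
  \<comment> \<open>Vector derivatives within the nontrivial interval \<open>{-1..1}\<close> are
    unique, so the one just found is the one selected by \<open>cube_partial\<close>.\<close>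
  then show ?thesis
    unfolding cube_partial_def VI
    using ti(1) by (intro vector_derivative_within_closed_interval) simp_all
qed

section \<open>Velocities as tangent vectors\<close>

lemma push_cell_id: "singular_cube M k \<tau> \<Longrightarrow> push_cell k (\<lambda>p. p) \<tau> = \<tau>"
  by (auto simp: singular_cube_def push_cell_def compose_def extensional_def fun_eq_iff)

text \<open>This is the chain rule for the identity of \<open>M\<close>, whose local representations
  are the transition maps. \<open>push_cell_id\<close> removes the push-forward.\<close>

lemma velocity_in_tangent_space:
  fixes M :: "('a, 'n::finite) manifold"
  assumes M: "smooth_manifold M" and \<tau>: "singular_cube M k \<tau>" and t: "t \<in> cube k" and i: "i < k"
  shows "velocity M \<tau> t i \<in> tangent_space M (\<tau> t)"
proof -
  have "velocity M \<tau> t i d = local_deriv c d (\<lambda>q. q) (\<tau> t) (velocity M \<tau> t i c)"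
    if c: "c \<in> charts_at M (\<tau> t)" and d: "d \<in> charts_at M (\<tau> t)" for c d
  proof -
    have "smooth_on (local_dom c d (\<lambda>q. q)) (local_rep c d (\<lambda>q. q))"
      using M c d by (auto simp: smooth_manifold_def charts_at_def)
    from cube_partial_push_cell[OF M M _ this \<tau> t i c d]
    show ?thesis
      using c d by (simp add: velocity_def push_cell_id[OF \<tau>])
  qed
  then show ?thesis
    unfolding tangent_space_def by (auto simp only: mem_Collect_eq) (simp add: velocity_def)
qed

text \<open>The chain rule holds in every chart around \<open>\<tau> t\<close>, hence in the one
  picked by \<open>SOME\<close> in \<open>tangent_map\<close>. Off the charts at the image point
  both sides are 0.\<close>

lemma tangent_map_velocity:
  fixes M :: "('a, 'n::finite) manifold" and N :: "('b, 'm::finite) manifold"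
  assumes M: "smooth_manifold M" and N: "smooth_manifold N"
    and f: "continuous_map (mtop M) (mtop N) f"
    and sm: "\<And>c d. c \<in> atlas M \<Longrightarrow> d \<in> atlas N \<Longrightarrow> smooth_on (local_dom c d f) (local_rep c d f)"
    and \<tau>: "singular_cube M k \<tau>" and t: "t \<in> cube k" and i: "i < k"
  shows "tangent_map M N f (\<tau> t) (velocity M \<tau> t i) = velocity N (push_cell k f \<tau>) t i"
proof -
  define c where "c = (SOME c. c \<in> charts_at M (\<tau> t))"
  have "\<exists>c. c \<in> charts_at M (\<tau> t)"
    using M singular_cube_points[OF \<tau> t] unfolding smooth_manifold_def charts_at_def by blast
  then have c: "c \<in> charts_at M (\<tau> t)"
    unfolding c_def by (rule someI_ex)
  have "local_deriv c d f (\<tau> t) (velocity M \<tau> t i c) = cube_partial i (snd d \<circ> push_cell k f \<tau>) t"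
    if d: "d \<in> charts_at N (f (\<tau> t))" for d
  proof -
    have "smooth_on (local_dom c d f) (local_rep c d f)"
      using c d sm by (auto simp: charts_at_def)
    from cube_partial_push_cell[OF M N f this \<tau> t i c d] show ?thesis
      using c by (simp add: velocity_def)
  qed
  then show ?thesis
    unfolding tangent_map_def velocity_def[of N] c_def[symmetric] push_cell_apply[OF t] Let_def
    by (intro ext) simp
qed

section \<open>Naturality of reduction\<close>

lemma cell_integral_push_cell:
  fixes M :: "('a, 'n::finite) manifold" and N :: "('b, 'm::finite) manifold"
  assumes M: "smooth_manifold M" and N: "smooth_manifold N"
    and f: "continuous_map (mtop M) (mtop N) f"
    and sm: "\<And>c d. c \<in> atlas M \<Longrightarrow> d \<in> atlas N \<Longrightarrow> smooth_on (local_dom c d f) (local_rep c d f)"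
    and \<tau>: "singular_cube M k \<tau>"
  shows "cell_integral N k (push_cell k f \<tau>) a = cell_integral M k \<tau> (pullback M N f a)"
proof -
  have "a (push_cell k f \<tau> t) (map (velocity N (push_cell k f \<tau>) t) [0..<k])
      = pullback M N f a (\<tau> t) (map (velocity M \<tau> t) [0..<k])" if t: "t \<in> cube k" for t
  proof -
    have "map (tangent_map M N f (\<tau> t)) (map (velocity M \<tau> t) [0..<k])
        = map (velocity N (push_cell k f \<tau>) t) [0..<k]"
      using tangent_map_velocity[OF M N f sm \<tau> t] by simp
    moreover have "set (map (velocity M \<tau> t) [0..<k]) \<subseteq> tangent_space M (\<tau> t)"
      using velocity_in_tangent_space[OF M \<tau> t] by auto
    ultimately show ?thesis
      \<comment> \<open>Deleting \<open>map_map\<close> keeps the two nested maps apart, so that the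
        first fact above can rewrite them.\<close>
      using singular_cube_points[OF \<tau> t]
      by (simp add: pullback_def push_cell_apply[OF t] del: map_map)
  qed
  then show ?thesis
    unfolding cell_integral_def set_lebesgue_integral_def
    by (intro Bochner_Integration.integral_cong) (auto simp: indicator_def)
qed

text \<open>The commutation of reconstruction with pullback is assumed on cochains only; this makes
  it applicable to reduced forms.\<close>

lemma reduction_in_cochain_space: "reduction M D k a \<in> cochain_space D k"
proof -
  have "(\<lambda>\<tau>. r * c \<tau> + c' \<tau>) \<in> chain_space D k"
    if "c \<in> chain_space D k" "c' \<in> chain_space D k" for r c c'
    using that by (auto simp: chain_space_def)
  then show ?thesis
    by (auto simp: cochain_space_def reduction_def sum.distrib sum_distrib_left algebra_simps)
qed

lemma chain_map_in_chain_space: "chain_map f D k c \<in> chain_space (push_complex f D) k"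
  by (auto simp: chain_space_def chain_map_def push_complex_def intro!: sum.neutral)

text \<open>The sum over \<open>D k\<close> is grouped by image cell. Cells with a common image
  contribute to one coefficient of \<open>chain_map\<close>.\<close>

lemma sum_chain_map:
  assumes "finite (D k)"
  shows "(\<Sum>\<sigma>\<in>push_complex f D k. chain_map f D k c \<sigma> * w \<sigma>) = (\<Sum>\<tau>\<in>D k. c \<tau> * w (push_cell k f \<tau>))"
proof -
  have "(\<Sum>\<tau>\<in>D k. c \<tau> * w (push_cell k f \<tau>))
      = (\<Sum>\<sigma>\<in>push_cell k f ` D k. \<Sum>\<tau> | \<tau> \<in> D k \<and> push_cell k f \<tau> = \<sigma>. c \<tau> * w (push_cell k f \<tau>))"
    by (rule sum.image_gen[OF assms])
  also have "\<dots> = (\<Sum>\<sigma>\<in>push_complex f D k. chain_map f D k c \<sigma> * w \<sigma>)"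
    by (simp add: push_complex_def chain_map_def sum_distrib_right)
  finally show ?thesis ..
qed

text \<open>On a chain of \<open>D\<close>, \<open>sum_chain_map\<close> moves the left side from
  the pushed cells back to \<open>D k\<close>; there the cell integrals agree one by one. Elsewhere
  both cochains are 0.\<close>

lemma cochain_map_reduction:
  fixes M :: "('a, 'n::finite) manifold" and N :: "('b, 'm::finite) manifold"
  assumes M: "smooth_manifold M" and N: "smooth_manifold N"
    and f: "smooth_homeomorphism M N f" and D: "cell_complex M D"
  shows "cochain_map f D k (reduction N (push_complex f D) k a) = reduction M D k (pullback M N f a)"
proof
  fix c
  have fin: "finite (D k)" and \<tau>: "\<And>\<tau>. \<tau> \<in> D k \<Longrightarrow> singular_cube M k \<tau>"
    using D by (auto simp: cell_complex_def)
  have f': "continuous_map (mtop M) (mtop N) f"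
    "\<And>c d. c \<in> atlas M \<Longrightarrow> d \<in> atlas N \<Longrightarrow> smooth_on (local_dom c d f) (local_rep c d f)"
    using f by (auto simp: smooth_homeomorphism_def homeomorphic_imp_continuous_map)
  show "cochain_map f D k (reduction N (push_complex f D) k a) c = reduction M D k (pullback M N f a) c"
    using cell_integral_push_cell[OF M N f' \<tau>]
    by (simp add: cochain_map_def reduction_def chain_map_in_chain_space sum_chain_map fin)
qed

section \<open>Commutation of projection and pullback\<close>

text \<open>Formulated for one complex and its push-forward, so that it serves the primal and the
  dual case alike. The commutation hypothesis is applied to the cochain obtained by reducing
  \<open>a\<close>.\<close>

lemma pullback_projection:
  fixes M :: "('a, 'n::finite) manifold" and N :: "('b, 'm::finite) manifold"
  assumes "smooth_manifold M" "smooth_manifold N" "smooth_homeomorphism M N f" "cell_complex M D"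
    and "\<forall>g\<in>cochain_space (push_complex f D) k. I (cochain_map f D k g) = pullback M N f (J g)"
  shows "pullback M N f (projection N (push_complex f D) k J a) = projection M D k I (pullback M N f a)"
  using bspec[OF assms(5) reduction_in_cochain_space, of N a]
  by (simp add: projection_def cochain_map_reduction[OF assms(1-4)])

theorem lemma6:
  fixes M :: "('a, 'n::finite) manifold" and N :: "('b, 'n) manifold"
    and \<Phi> :: "'a \<Rightarrow> 'b" and k :: nat
    and D\<^sub>M D'\<^sub>M :: "nat \<Rightarrow> 'a cell set" and D\<^sub>N D'\<^sub>N :: "nat \<Rightarrow> 'b cell set"
    and I\<^sub>M I'\<^sub>M :: "'a cochain \<Rightarrow> ('a, 'n) form" and I\<^sub>N I'\<^sub>N :: "'b cochain \<Rightarrow> ('b, 'n) form"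
    and \<pi>\<^sub>M :: "('a, 'n) form \<Rightarrow> ('a, 'n) form" and \<pi>\<^sub>N :: "('b, 'n) form \<Rightarrow> ('b, 'n) form"
  assumes "smooth_manifold M" and "smooth_manifold N"
    and "smooth_homeomorphism M N \<Phi>"
    \<comment> \<open>primal complexes\<close>
    and "cell_complex M D\<^sub>M" and "cell_complex N D\<^sub>N" and "D\<^sub>N = push_complex \<Phi> D\<^sub>M"
    and "reconstruction M D\<^sub>M k I\<^sub>M" and "reconstruction N D\<^sub>N k I\<^sub>N"
    and "\<forall>f\<in>cochain_space D\<^sub>N k. I\<^sub>M (cochain_map \<Phi> D\<^sub>M k f) = pullback M N \<Phi> (I\<^sub>N f)"
    \<comment> \<open>dual complexes\<close>
    and "dual_complex M D\<^sub>M D'\<^sub>M" and "dual_complex N D\<^sub>N D'\<^sub>N"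
    and "cell_complex M D'\<^sub>M" and "cell_complex N D'\<^sub>N" and "D'\<^sub>N = push_complex \<Phi> D'\<^sub>M"
    and "reconstruction M D'\<^sub>M k I'\<^sub>M" and "reconstruction N D'\<^sub>N k I'\<^sub>N"
    and "\<forall>f\<in>cochain_space D'\<^sub>N k. I'\<^sub>M (cochain_map \<Phi> D'\<^sub>M k f) = pullback M N \<Phi> (I'\<^sub>N f)"
    \<comment> \<open>the projections are the primal ones or the dual ones\<close>
    and "\<pi>\<^sub>M = projection M D\<^sub>M k I\<^sub>M \<and> \<pi>\<^sub>N = projection N D\<^sub>N k I\<^sub>N \<or>
         \<pi>\<^sub>M = projection M D'\<^sub>M k I'\<^sub>M \<and> \<pi>\<^sub>N = projection N D'\<^sub>N k I'\<^sub>N"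
  shows "\<forall>a\<in>diff_forms N k. pullback M N \<Phi> (\<pi>\<^sub>N a) = \<pi>\<^sub>M (pullback M N \<Phi> a)"
  using assms(18)
proof
  assume "\<pi>\<^sub>M = projection M D\<^sub>M k I\<^sub>M \<and> \<pi>\<^sub>N = projection N D\<^sub>N k I\<^sub>N"
  then show ?thesis
    using pullback_projection[OF assms(1-4) assms(9)[unfolded assms(6)]] assms(6) by simp
next
  assume "\<pi>\<^sub>M = projection M D'\<^sub>M k I'\<^sub>M \<and> \<pi>\<^sub>N = projection N D'\<^sub>N k I'\<^sub>N"
  then show ?thesis
    using pullback_projection[OF assms(1-3) assms(12) assms(17)[unfolded assms(14)]] assms(14)
    by simp
qed

end
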